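(* Let $f \in \mathbb{C}\{z_1,\dots,z_n\}$ define an isolated singularity at the origin $0 \in \mathbb{C}^n$. Let $H$ be an arbitrary hyperplane in $\mathbb{R}^n$ lying below the Newton boundary $\Gamma(f)$ and intersecting the coordinate axes $x_1,\dots,x_n$ at the points with coordinates $a_1,\dots,a_n$ respectively (i.e. at $(a_1,0,\dots,0),\dots,(0,\dots,0,a_n)$), where $a_i \ge 1$ for $i=1,\dots,n$ (the $a_i$ are real numbers, not necessarily integers). Then $$\mu(f,0) \ \ge\ (a_1-1)\cdot \dots \cdot (a_n-1).$$
   Context: $\mathbb{C}\{z_1,\dots,z_n\}$ is the ring of convergent power series; $f(0)=0$ and $f$ has an isolated critical point at $0$. $\mu(f,0)=\dim_{\mathbb{C}} \mathbb{C}\{z_1,\dots,z_n\}/(\partial f/\partial z_1,\dots,\partial f/\partial z_n)$ is the Milnor number. Write $f=\sum_\lambda \gamma_\lambda z^\lambda$. The Newton boundary $\Gamma(f)$ (with respect to the fixed coordinates) is the union of the compact faces of the convex hull of $\bigcup_{\gamma_\lambda\neq 0}(\lambda+(\mathbb{R}_{\ge 0})^n)$. The hyperplane $H=\{x\in\mathbb{R}^n : x_1/a_1+\dots+x_n/a_n=1\}$ lies below $\Gamma(f)$ if $x_1/a_1+\dots+x_n/a_n\ge 1$ for every $x\in\Gamma(f)$. The function $f$ is not assumed convenient. *)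

theory Defs
  imports "HOL-Analysis.Analysis" "HOL-Algebra.Embedded_Algebras" "HOL-Algebra.QuotRing"
begin

(* A formal power series in variables indexed by the finite type 'n is its family of
   coefficients; for n variables take CARD('n) = n. *)
type_synonym 'n pseries = "nat ^ 'n \<Rightarrow> complex"

definition monomial_at :: "complex ^ 'n \<Rightarrow> nat ^ 'n \<Rightarrow> complex" where
  "monomial_at z \<alpha> = (\<Prod>i\<in>UNIV. (z $ i) ^ (\<alpha> $ i))"

definition ps_convergent :: "'n::finite pseries \<Rightarrow> bool" where
  "ps_convergent f \<longleftrightarrow> (\<forall>\<^sub>F z in nhds 0. (\<lambda>\<alpha>. f \<alpha> * monomial_at z \<alpha>) summable_on UNIV)"

(* The value of f at z; meaningful only where the series converges. *)
definition ps_eval :: "'n::finite pseries \<Rightarrow> complex ^ 'n \<Rightarrow> complex" where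
  "ps_eval f z = (\<Sum>\<^sub>\<infinity>\<alpha>. f \<alpha> * monomial_at z \<alpha>)"

definition ps_const :: "complex \<Rightarrow> 'n::finite pseries" where
  "ps_const c = (\<lambda>\<alpha>. if \<alpha> = 0 then c else 0)"

definition ps_mult :: "'n::finite pseries \<Rightarrow> 'n pseries \<Rightarrow> 'n pseries" where
  "ps_mult f g = (\<lambda>\<gamma>. \<Sum>(\<alpha>, \<beta>) | \<alpha> + \<beta> = \<gamma>. f \<alpha> * g \<beta>)"

definition ps_partial :: "'n \<Rightarrow> 'n::finite pseries \<Rightarrow> 'n pseries" where
  "ps_partial i f = (\<lambda>\<alpha>. of_nat (\<alpha> $ i + 1) * f (\<alpha> + axis i 1))"

definition conv_ps_ring :: "'n::finite pseries ring" where
  "conv_ps_ring = \<lparr>carrier = {f. ps_convergent f}, mult = ps_mult, one = ps_const 1,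
     zero = ps_const 0, add = (\<lambda>f g \<alpha>. f \<alpha> + g \<alpha>)\<rparr>"

definition isolated_singularity :: "'n::finite pseries \<Rightarrow> bool" where
  "isolated_singularity f \<longleftrightarrow> ps_eval f 0 = 0 \<and>
     (\<forall>i. ps_eval (ps_partial i f) 0 = 0) \<and>
     (\<forall>\<^sub>F z in at 0. \<exists>i. ps_eval (ps_partial i f) z \<noteq> 0)"

definition jacobian_ideal :: "'n::finite pseries \<Rightarrow> 'n pseries set" where
  "jacobian_ideal f = Idl\<^bsub>conv_ps_ring\<^esub> (range (\<lambda>i. ps_partial i f))"

definition milnor_algebra :: "'n::finite pseries \<Rightarrow> 'n pseries set ring" where
  "milnor_algebra f = conv_ps_ring Quot jacobian_ideal f"

definition milnor_scalars :: "'n::finite pseries \<Rightarrow> 'n pseries set set" where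
  "milnor_scalars f = range (\<lambda>c. jacobian_ideal f +>\<^bsub>conv_ps_ring\<^esub> ps_const c)"

(* The complex dimension of the Milnor algebra, with value \<infinity> if it is infinite-dimensional;
   the complex scalars act through their image milnor_scalars f in the quotient ring. *)
definition milnor_number :: "'n::finite pseries \<Rightarrow> enat" where
  "milnor_number f =
     (if ring.finite_dimension (milnor_algebra f) (milnor_scalars f) (carrier (milnor_algebra f))
      then enat (ring.dim (milnor_algebra f) (milnor_scalars f) (carrier (milnor_algebra f)))
      else \<infinity>)"

definition newton_polyhedron :: "'n::finite pseries \<Rightarrow> (real ^ 'n) set" where
  "newton_polyhedron f =
     convex hull (\<Union>\<alpha>\<in>{\<alpha>. f \<alpha> \<noteq> 0}. {(\<chi> i. real (\<alpha> $ i)) + v | v. \<forall>i. 0 \<le> v $ i})"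

definition newton_boundary :: "'n::finite pseries \<Rightarrow> (real ^ 'n) set" where
  "newton_boundary f = \<Union>{F. F face_of newton_polyhedron f \<and> compact F}"

(* The hyperplane with axis intercepts a, i.e. {x. x_1/a_1 + ... + x_n/a_n = 1}, lies below G. *)
definition intercept_hyperplane_below :: "real ^ 'n::finite \<Rightarrow> (real ^ 'n) set \<Rightarrow> bool" where
  "intercept_hyperplane_below a G \<longleftrightarrow> (\<forall>x\<in>G. (\<Sum>i\<in>UNIV. x $ i / a $ i) \<ge> 1)"

end

theory Submission
  imports Defs "HOL-Library.Function_Algebras" "HOL-Real_Asymp.Real_Asymp"
begin

text \<open>
Give the variable $z_i$ the weight $w_i = 1/a_i$. That the hyperplane lies below the Newton
boundary means that every monomial of $f$ has weight at least $1$
(\<open>weight_ge_1_if_hyperplane_below\<close>), so that all monomials of the partial derivative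
$g_i = \partial f/\partial z_i$ have weight at least $d_i = 1 - w_i$. Since $d_i/w_i = a_i - 1$,
the claim is the weighted Bezout-type estimate $\mu \ge \prod_i d_i/w_i$ for the codimension
$\mu$ of the ideal $I = (g_1, \dots, g_n)$. If some $a_i = 1$ or $\mu = \infty$, nothing has to
be shown; assume that all $d_i > 0$ and that $\mu$ is finite.

The estimate follows by comparing two filtrations, without any intersection theory. Let
$h_1, \dots, h_\mu$ span the ring of convergent power series modulo $I$. Expanding a series again
and again, $p = \sum_j c_j h_j + \sum_i q_i g_i$ and then likewise each $q_i$, shows that up to
terms of weight greater than $N$ every series is a linear combination of the products
$h_j g^\beta$ with $\sum_i d_i \beta_i \le N$ (\<open>trunc_gen_monomial_in_span\<close>); the other
products $g^\beta$ have weight greater than $N$. Conversely, the monomials $z^\alpha$ with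
$\sum_i w_i \alpha_i \le N$ are linearly independent modulo the series of weight greater than $N$.
Counting dimensions gives, for every real $N$,
\[ \#\{\alpha : w \cdot \alpha \le N\} \le \mu \cdot \#\{\beta : d \cdot \beta \le N\} \]
(\<open>card_sublevel_le\<close>). Multiplying by $t e^{-tN}$ and integrating over $N$ turns both counts
into products of geometric series, $\prod_i (1 - e^{-t w_i})^{-1} \le
\mu \prod_i (1 - e^{-t d_i})^{-1}$, and $t \to 0$ yields $\prod_i d_i/w_i \le \mu$
(\<open>prod_ratio_le_if_counting_le\<close>).
\<close>

section \<open>Weights of multi-indices\<close>

definition weight :: "('n \<Rightarrow> real) \<Rightarrow> nat ^ 'n::finite \<Rightarrow> real" where
  "weight w \<alpha> = (\<Sum>i\<in>UNIV. w i * real (\<alpha> $ i))"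

lemma weight_zero [simp]: "weight w 0 = 0"
  by (simp add: weight_def)

lemma weight_add: "weight w (\<alpha> + \<beta>) = weight w \<alpha> + weight w \<beta>"
  by (simp add: weight_def sum.distrib algebra_simps)

lemma weight_axis [simp]: "weight w (axis i (Suc 0)) = w i"
proof -
  have "(\<Sum>j\<in>UNIV. w j * real (axis i (Suc 0) $ j)) = (\<Sum>j\<in>UNIV. if j = i then w j else 0)"
    by (rule sum.cong) (auto simp: axis_def)
  then show ?thesis by (simp add: weight_def)
qed

lemma weight_nonneg: "(\<And>i. 0 \<le> w i) \<Longrightarrow> 0 \<le> weight w \<alpha>"
  by (simp add: weight_def sum_nonneg)

lemma coord_le_weight:
  assumes "\<And>i. 0 \<le> w i"
  shows "w i * real (\<alpha> $ i) \<le> weight w \<alpha>"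
  unfolding weight_def by (rule member_le_sum) (use assms in auto)

lemma finite_multiindices_le: "finite {\<alpha> :: nat ^ 'n::finite. \<forall>i. \<alpha> $ i \<le> k i}"
proof -
  have "finite (vec_lambda ` PiE (UNIV :: 'n set) (\<lambda>i. {..k i}))"
    by (intro finite_imageI finite_PiE) auto
  moreover have "{\<alpha> :: nat ^ 'n. \<forall>i. \<alpha> $ i \<le> k i} \<subseteq> vec_lambda ` PiE UNIV (\<lambda>i. {..k i})"
  proof
    fix \<alpha> :: "nat ^ 'n" assume "\<alpha> \<in> {\<alpha>. \<forall>i. \<alpha> $ i \<le> k i}"
    then have "vec_nth \<alpha> \<in> PiE UNIV (\<lambda>i. {..k i})" by auto
    then show "\<alpha> \<in> vec_lambda ` PiE UNIV (\<lambda>i. {..k i})"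
      by (metis image_eqI vec_nth_inverse)
  qed
  ultimately show ?thesis by (rule rev_finite_subset)
qed

lemma finite_weight_le:
  assumes "\<And>i. 0 < w i"
  shows "finite {\<alpha> :: nat ^ 'n::finite. weight w \<alpha> \<le> N}"
proof (rule finite_subset[OF _ finite_multiindices_le])
  show "{\<alpha> :: nat ^ 'n. weight w \<alpha> \<le> N} \<subseteq> {\<alpha>. \<forall>i. \<alpha> $ i \<le> nat \<lceil>N / w i\<rceil>}"
  proof safe
    fix \<alpha> :: "nat ^ 'n" and i assume "weight w \<alpha> \<le> N"
    then have "w i * real (\<alpha> $ i) \<le> N"
      using coord_le_weight[of w i \<alpha>] assms by (meson less_imp_le order.trans)
    then have "real (\<alpha> $ i) \<le> N / w i"
      using assms by (simp add: field_simps)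
    then show "\<alpha> $ i \<le> nat \<lceil>N / w i\<rceil>" by linarith
  qed
qed

section \<open>The ring of convergent power series\<close>

lemma finite_splittings: "finite {(\<alpha>, \<beta>). \<alpha> + \<beta> = (\<gamma> :: nat ^ 'n::finite)}"
proof (rule finite_subset)
  show "finite ({\<alpha> :: nat ^ 'n. \<forall>i. \<alpha> $ i \<le> \<gamma> $ i} \<times> {\<alpha>. \<forall>i. \<alpha> $ i \<le> \<gamma> $ i})"
    by (intro finite_cartesian_product finite_multiindices_le)
qed auto

lemma ps_mult_commute: "ps_mult f g = ps_mult g f"
  unfolding ps_mult_def
  by (rule ext, rule sum.reindex_bij_witness[of _ "\<lambda>(a, b). (b, a)" "\<lambda>(a, b). (b, a)"])
     (auto simp: add.commute mult.commute)

lemma ps_mult_assoc: "ps_mult (ps_mult f g) h = ps_mult f (ps_mult g h)"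
proof
  fix \<delta> :: "nat ^ 'a"
  let ?S = "\<lambda>\<epsilon> :: nat ^ 'a. {(\<alpha>, \<beta>). \<alpha> + \<beta> = \<epsilon>}"
  have "ps_mult (ps_mult f g) h \<delta>
      = (\<Sum>x\<in>?S \<delta>. \<Sum>y\<in>?S (fst x). f (fst y) * g (snd y) * h (snd x))"
    unfolding ps_mult_def by (simp add: sum_distrib_right case_prod_unfold)
  also have "\<dots> = (\<Sum>(x, y)\<in>Sigma (?S \<delta>) (\<lambda>x. ?S (fst x)). f (fst y) * g (snd y) * h (snd x))"
    by (rule sum.Sigma) (auto simp: finite_splittings)
  also have "\<dots> = (\<Sum>(x, y)\<in>Sigma (?S \<delta>) (\<lambda>x. ?S (snd x)). f (fst x) * (g (fst y) * h (snd y)))"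
    by (rule sum.reindex_bij_witness[of _ "\<lambda>((a, _), (b, c)). ((a + b, c), (a, b))"
          "\<lambda>((_, c), (a, b)). ((a, b + c), (b, c))"])
       (auto simp: add.assoc mult.assoc)
  also have "\<dots> = (\<Sum>x\<in>?S \<delta>. \<Sum>y\<in>?S (snd x). f (fst x) * (g (fst y) * h (snd y)))"
    by (rule sum.Sigma[symmetric]) (auto simp: finite_splittings)
  also have "\<dots> = ps_mult f (ps_mult g h) \<delta>"
    unfolding ps_mult_def by (simp add: sum_distrib_left case_prod_unfold)
  finally show "ps_mult (ps_mult f g) h \<delta> = ps_mult f (ps_mult g h) \<delta>" .
qed

lemma ps_mult_const: "ps_mult (ps_const c) f = (\<lambda>\<alpha>. c * f \<alpha>)"
proof
  fix \<gamma> :: "nat ^ 'a"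
  have "ps_mult (ps_const c) f \<gamma> = (\<Sum>(\<alpha>, \<beta>)\<in>{(0 :: nat ^ 'a, \<gamma>)}. ps_const c \<alpha> * f \<beta>)"
    unfolding ps_mult_def
    by (rule sum.mono_neutral_right) (auto simp: finite_splittings ps_const_def split: if_splits)
  then show "ps_mult (ps_const c) f \<gamma> = c * f \<gamma>" by (simp add: ps_const_def)
qed

lemma ps_mult_add_left: "ps_mult (f + g) h = ps_mult f h + ps_mult g h"
  by (rule ext) (simp add: ps_mult_def case_prod_unfold sum.distrib distrib_right)

abbreviation total_degree :: "nat ^ 'n::finite \<Rightarrow> nat" where
  "total_degree \<alpha> \<equiv> (\<Sum>i\<in>UNIV. \<alpha> $ i)"

lemma norm_monomial_at_le:
  assumes "\<And>i. norm (z $ i) \<le> r"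
  shows "norm (monomial_at z \<alpha>) \<le> r ^ total_degree \<alpha>"
proof -
  have "norm (monomial_at z \<alpha>) = (\<Prod>i\<in>UNIV. norm (z $ i) ^ (\<alpha> $ i))"
    by (simp add: monomial_at_def norm_power flip: prod_norm)
  also have "\<dots> \<le> (\<Prod>i\<in>UNIV. r ^ (\<alpha> $ i))"
    by (intro prod_mono conjI power_mono assms) auto
  finally show ?thesis by (simp add: power_sum)
qed

text \<open>A single radius suffices, by comparing with the point all of whose coordinates equal \<open>r\<close>.
In this form convergence is absolute summability of one real family, so that products and
derivatives can be treated by majorants.\<close>
lemma ps_convergent_iff:
  "ps_convergent f \<longleftrightarrow> (\<exists>r>0. (\<lambda>\<alpha>. norm (f \<alpha>) * r ^ total_degree \<alpha>) summable_on UNIV)"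
proof
  assume "ps_convergent f"
  then obtain e where e: "e > 0"
    and sum: "\<And>z. norm z < e \<Longrightarrow> (\<lambda>\<alpha>. f \<alpha> * monomial_at z \<alpha>) summable_on UNIV"
    unfolding ps_convergent_def eventually_nhds_metric by (auto simp: dist_norm)
  define r where "r = e / (2 * real CARD('a))"
  define z :: "complex ^ 'a" where "z = (\<chi> i. of_real r)"
  have r: "r > 0" using e by (simp add: r_def)
  have "norm z \<le> (\<Sum>i\<in>UNIV. norm (z $ i))"
    by (simp add: norm_vec_def L2_set_le_sum)
  also have "\<dots> = real CARD('a) * r" using r by (simp add: z_def)
  also have "\<dots> = e / 2" by (simp add: r_def)
  finally have "norm z < e" using e by simp
  from sum[OF this] have "(\<lambda>\<alpha>. norm (f \<alpha> * monomial_at z \<alpha>)) summable_on UNIV"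
    by (simp add: summable_on_iff_abs_summable_on_complex)
  also have "(\<lambda>\<alpha>. norm (f \<alpha> * monomial_at z \<alpha>)) = (\<lambda>\<alpha>. norm (f \<alpha>) * r ^ total_degree \<alpha>)"
    using r by (simp add: norm_mult z_def monomial_at_def norm_power power_sum flip: prod_norm)
  finally show "\<exists>r>0. (\<lambda>\<alpha>. norm (f \<alpha>) * r ^ total_degree \<alpha>) summable_on UNIV"
    using r by blast
next
  assume "\<exists>r>0. (\<lambda>\<alpha>. norm (f \<alpha>) * r ^ total_degree \<alpha>) summable_on UNIV"
  then obtain r where r: "r > 0"
    and sum: "(\<lambda>\<alpha>. norm (f \<alpha>) * r ^ total_degree \<alpha>) summable_on UNIV" by blast
  have "(\<lambda>\<alpha>. f \<alpha> * monomial_at z \<alpha>) summable_on UNIV" if "norm z < r" for z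
  proof -
    have "norm (monomial_at z \<alpha>) \<le> r ^ total_degree \<alpha>" for \<alpha>
      by (rule norm_monomial_at_le) (use that Finite_Cartesian_Product.norm_nth_le[of z] in \<open>meson less_imp_le order.trans\<close>)
    then have "norm (f \<alpha> * monomial_at z \<alpha>) \<le> norm (f \<alpha>) * r ^ total_degree \<alpha>" for \<alpha>
      by (simp add: norm_mult mult_left_mono)
    with sum have "(\<lambda>\<alpha>. norm (f \<alpha> * monomial_at z \<alpha>)) summable_on UNIV"
      by (intro summable_on_comparison_test[OF sum]) auto
    then show ?thesis by (rule abs_summable_summable)
  qed
  then show "ps_convergent f"
    unfolding ps_convergent_def eventually_nhds_metric using r by (auto simp: dist_norm)
qed

lemma abs_summable_smaller_radius:
  fixes f :: "'n::finite pseries"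
  assumes "(\<lambda>\<alpha>. norm (f \<alpha>) * r ^ total_degree \<alpha>) summable_on UNIV" "0 \<le> s" "s \<le> r"
  shows "(\<lambda>\<alpha>. norm (f \<alpha>) * s ^ total_degree \<alpha>) summable_on UNIV"
  by (intro summable_on_comparison_test[OF assms(1)]) (use assms in \<open>auto intro!: mult_left_mono power_mono\<close>)

lemma ps_convergent_common_radius:
  assumes "ps_convergent f" "ps_convergent g"
  obtains r where "r > 0"
    "(\<lambda>\<alpha>. norm (f \<alpha>) * r ^ total_degree \<alpha>) summable_on UNIV"
    "(\<lambda>\<alpha>. norm (g \<alpha>) * r ^ total_degree \<alpha>) summable_on UNIV"
proof -
  obtain r s where "r > 0" "s > 0" "(\<lambda>\<alpha>. norm (f \<alpha>) * r ^ total_degree \<alpha>) summable_on UNIV"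
    "(\<lambda>\<alpha>. norm (g \<alpha>) * s ^ total_degree \<alpha>) summable_on UNIV"
    using assms unfolding ps_convergent_iff by blast
  then show thesis
    by (intro that[of "min r s"]) (auto intro: abs_summable_smaller_radius)
qed

lemma ps_convergent_add:
  assumes "ps_convergent f" "ps_convergent g"
  shows "ps_convergent (f + g)"
proof -
  obtain r where r: "r > 0"
    "(\<lambda>\<alpha>. norm (f \<alpha>) * r ^ total_degree \<alpha>) summable_on UNIV"
    "(\<lambda>\<alpha>. norm (g \<alpha>) * r ^ total_degree \<alpha>) summable_on UNIV"
    using ps_convergent_common_radius[OF assms] .
  have "(\<lambda>\<alpha>. norm ((f + g) \<alpha>) * r ^ total_degree \<alpha>) summable_on UNIV"
    by (intro summable_on_comparison_test[OF summable_on_add[OF r(2,3)]])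
       (use r in \<open>auto simp flip: distrib_right intro!: mult_right_mono norm_triangle_ineq\<close>)
  with r(1) show ?thesis unfolding ps_convergent_iff by blast
qed

lemma ps_convergent_finite_support:
  assumes "finite {\<alpha>. f \<alpha> \<noteq> 0}"
  shows "ps_convergent f"
  unfolding ps_convergent_iff
proof (intro exI[of _ 1] conjI)
  have "(\<lambda>\<alpha>. norm (f \<alpha>) * 1 ^ total_degree \<alpha>) summable_on {\<alpha>. f \<alpha> \<noteq> 0}"
    using assms by (rule summable_on_finite)
  then show "(\<lambda>\<alpha>. norm (f \<alpha>) * 1 ^ total_degree \<alpha>) summable_on UNIV"
    by (rule summable_on_cong_neutral[THEN iffD1, rotated -1]) auto
qed simp

lemma ps_convergent_const: "ps_convergent (ps_const c)"
  by (rule ps_convergent_finite_support, rule finite_subset[of _ "{0}"]) (auto simp: ps_const_def)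

text \<open>The norm of a coefficient of the Cauchy product is at most the corresponding sum of the products
of the norms, and the absolutely summable double series may be summed along the antidiagonals.\<close>
lemma ps_convergent_mult:
  assumes "ps_convergent f" "ps_convergent g"
  shows "ps_convergent (ps_mult f g)"
proof -
  obtain r where r: "r > 0"
    "(\<lambda>\<alpha>. norm (f \<alpha>) * r ^ total_degree \<alpha>) summable_on UNIV"
    "(\<lambda>\<alpha>. norm (g \<alpha>) * r ^ total_degree \<alpha>) summable_on UNIV"
    using ps_convergent_common_radius[OF assms] .
  define F where "F = (\<lambda>\<alpha>. norm (f \<alpha>) * r ^ total_degree \<alpha>)"
  define G where "G = (\<lambda>\<alpha>. norm (g \<alpha>) * r ^ total_degree \<alpha>)"
  let ?S = "\<lambda>\<epsilon> :: nat ^ 'a. {(\<alpha>, \<beta>). \<alpha> + \<beta> = \<epsilon>}"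
  have nonneg: "F \<alpha> \<ge> 0" "G \<alpha> \<ge> 0" for \<alpha> using r by (auto simp: F_def G_def)
  have "(\<lambda>x. F (fst x) * G (snd x)) summable_on Sigma UNIV (\<lambda>_. UNIV)"
    using r(2,3) nonneg
    by (intro summable_on_SigmaI[where g = "\<lambda>x. F x * infsum G UNIV"])
       (auto intro!: has_sum_cmult_right summable_on_cmult_left has_sum_infsum simp: F_def G_def)
  also have "?this \<longleftrightarrow> (\<lambda>(\<gamma>, x). F (fst x) * G (snd x)) summable_on (Sigma UNIV ?S)"
    by (rule summable_on_reindex_bij_witness[of _ "\<lambda>(\<gamma>, x). x" "\<lambda>x. (fst x + snd x, x)"]) auto
  finally have sum: "(\<lambda>\<gamma>. \<Sum>x\<in>?S \<gamma>. F (fst x) * G (snd x)) summable_on UNIV"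
    using summable_on_Sigma_banach[of "\<lambda>_ x. F (fst x) * G (snd x)" UNIV ?S]
    by (simp add: finite_splittings)
  have bound: "norm (ps_mult f g \<gamma>) * r ^ total_degree \<gamma> \<le> (\<Sum>x\<in>?S \<gamma>. F (fst x) * G (snd x))" for \<gamma>
  proof -
    have "norm (ps_mult f g \<gamma>) \<le> (\<Sum>x\<in>?S \<gamma>. norm (f (fst x)) * norm (g (snd x)))"
      unfolding ps_mult_def by (rule sum_norm_le) (auto simp: norm_mult case_prod_unfold)
    then have "norm (ps_mult f g \<gamma>) * r ^ total_degree \<gamma>
        \<le> (\<Sum>x\<in>?S \<gamma>. norm (f (fst x)) * norm (g (snd x))) * r ^ total_degree \<gamma>"
      using r by (intro mult_right_mono) auto
    also have "\<dots> = (\<Sum>x\<in>?S \<gamma>. F (fst x) * G (snd x))"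
      unfolding sum_distrib_right
      by (rule sum.cong) (auto simp: F_def G_def sum.distrib power_add)
    finally show ?thesis .
  qed
  have "(\<lambda>\<gamma>. norm (ps_mult f g \<gamma>) * r ^ total_degree \<gamma>) summable_on UNIV"
    using r(1) by (intro summable_on_comparison_test[OF sum bound]) auto
  with r(1) show ?thesis unfolding ps_convergent_iff by blast
qed

text \<open>Halving the radius gains the factor \<open>2 ^ total_degree \<alpha>\<close>, which is at least the factor
\<open>\<alpha> $ i + 1\<close> introduced by differentiation.\<close>
lemma ps_convergent_partial:
  assumes "ps_convergent f"
  shows "ps_convergent (ps_partial i f)"
proof -
  obtain r where r: "r > 0" and sum: "(\<lambda>\<alpha>. norm (f \<alpha>) * r ^ total_degree \<alpha>) summable_on UNIV"
    using assms unfolding ps_convergent_iff by blast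
  have "inj_on (\<lambda>\<alpha> :: nat ^ 'a. \<alpha> + axis i 1) UNIV" by (simp add: inj_on_def)
  then have "(\<lambda>\<alpha>. norm (f (\<alpha> + axis i 1)) * r ^ total_degree (\<alpha> + axis i 1)) summable_on UNIV"
    using summable_on_subset_banach[OF sum, of "range (\<lambda>\<alpha>. \<alpha> + axis i 1)"]
    by (simp add: summable_on_reindex o_def)
  moreover have "total_degree (\<alpha> + axis i 1) = Suc (total_degree \<alpha>)" for \<alpha> :: "nat ^ 'a"
  proof -
    have "(\<Sum>j\<in>UNIV. axis i (1::nat) $ j) = (\<Sum>j\<in>UNIV. if j = i then 1 else 0)"
      by (rule sum.cong) (auto simp: axis_def)
    then show ?thesis by (simp add: sum.distrib)
  qed
  ultimately have shifted: "(\<lambda>\<alpha>. norm (f (\<alpha> + axis i 1)) * r ^ Suc (total_degree \<alpha>) * inverse r) summable_on UNIV"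
    by (intro summable_on_cmult_left) simp
  have "(\<lambda>\<alpha>. norm (ps_partial i f \<alpha>) * (r / 2) ^ total_degree \<alpha>) summable_on UNIV"
  proof (rule summable_on_comparison_test[OF shifted])
    fix \<alpha> :: "nat ^ 'a"
    have "\<alpha> $ i \<le> total_degree \<alpha>" by (rule member_le_sum) auto
    also have "total_degree \<alpha> < 2 ^ total_degree \<alpha>" by (rule less_exp)
    finally have "real (\<alpha> $ i + 1) \<le> 2 ^ total_degree \<alpha>"
      by (metis Suc_eq_plus1 Suc_leI of_nat_le_iff of_nat_numeral of_nat_power)
    then have "real (\<alpha> $ i + 1) * (r / 2) ^ total_degree \<alpha> \<le> 2 ^ total_degree \<alpha> * (r / 2) ^ total_degree \<alpha>"
      using r by (intro mult_right_mono) auto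
    also have "\<dots> = r ^ total_degree \<alpha>"
      by (simp flip: power_mult_distrib)
    finally have "real (\<alpha> $ i + 1) * (r / 2) ^ total_degree \<alpha> \<le> r ^ total_degree \<alpha>" .
    then have "norm (f (\<alpha> + axis i 1)) * (real (\<alpha> $ i + 1) * (r / 2) ^ total_degree \<alpha>)
        \<le> norm (f (\<alpha> + axis i 1)) * r ^ total_degree \<alpha>"
      by (rule mult_left_mono) simp
    also have "\<dots> = norm (f (\<alpha> + axis i 1)) * r ^ Suc (total_degree \<alpha>) * inverse r"
      using r by simp
    finally show "norm (ps_partial i f \<alpha>) * (r / 2) ^ total_degree \<alpha>
        \<le> norm (f (\<alpha> + axis i 1)) * r ^ Suc (total_degree \<alpha>) * inverse r"
      by (simp add: ps_partial_def norm_mult mult_ac del: of_nat_add of_nat_Suc flip: of_nat_Suc)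
  qed (use r in auto)
  with r show ?thesis unfolding ps_convergent_iff by (intro exI[of _ "r / 2"]) auto
qed

lemma conv_ps_ring_simps [simp]:
  "carrier conv_ps_ring = {f :: 'n::finite pseries. ps_convergent f}"
  "mult conv_ps_ring = (ps_mult :: 'n pseries \<Rightarrow> _)"
  "one conv_ps_ring = (ps_const 1 :: 'n pseries)"
  "zero conv_ps_ring = (0 :: 'n pseries)"
  "add conv_ps_ring = ((+) :: 'n pseries \<Rightarrow> _)"
  by (auto simp: conv_ps_ring_def ps_const_def fun_eq_iff)

lemma ps_const_simps:
  "ps_const 0 = 0" "ps_const a + ps_const b = ps_const (a + b)"
  "ps_mult (ps_const a) (ps_const b) = ps_const (a * b)"
  unfolding ps_mult_const by (auto simp: ps_const_def fun_eq_iff)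

lemma ps_mult_one [simp]: "ps_mult (ps_const 1) f = f" "ps_mult f (ps_const 1) = f"
  using ps_mult_const[of 1 f] by (simp_all add: ps_mult_commute)

lemma ps_mult_zero [simp]: "ps_mult 0 f = 0" "ps_mult f 0 = 0"
  using ps_mult_const[of 0 f] by (simp_all add: ps_mult_commute[of f] ps_const_simps fun_eq_iff)

lemma ps_mult_neg_one_add: "ps_mult (ps_const (-1)) f + f = 0"
  by (simp add: ps_mult_const fun_eq_iff)

lemma cring_conv_ps_ring: "cring (conv_ps_ring :: 'n::finite pseries ring)"
proof (rule cringI)
  show "abelian_group (conv_ps_ring :: 'n pseries ring)"
  proof (rule abelian_groupI)
    show "\<exists>y\<in>carrier conv_ps_ring. y \<oplus>\<^bsub>conv_ps_ring\<^esub> x = \<zero>\<^bsub>conv_ps_ring\<^esub>"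
      if "x \<in> carrier conv_ps_ring" for x :: "'n pseries"
      using that ps_mult_neg_one_add[of x]
      by (auto intro!: bexI[of _ "ps_mult (ps_const (-1)) x"] ps_convergent_mult ps_convergent_const)
  qed (use ps_convergent_const[of 0] in \<open>auto simp: ps_convergent_add ps_const_simps add_ac\<close>)
  show "comm_monoid (conv_ps_ring :: 'n pseries ring)"
    by (rule comm_monoidI)
       (simp_all add: ps_convergent_mult ps_convergent_const ps_mult_assoc, simp add: ps_mult_commute)
qed (simp add: ps_mult_add_left)

interpretation conv_ps: cring "conv_ps_ring :: 'n::finite pseries ring"
  by (rule cring_conv_ps_ring)

lemma ps_mult_add_right: "ps_mult h (f + g) = ps_mult h f + ps_mult h g"
  by (metis ps_mult_add_left ps_mult_commute)

lemma a_inv_conv_ps_ring: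
  assumes "ps_convergent f"
  shows "a_inv conv_ps_ring f = ps_mult (ps_const (-1)) f"
  by (rule conv_ps.minus_equality)
     (simp_all add: assms ps_mult_neg_one_add ps_convergent_mult ps_convergent_const)

lemma subgroup_conv_ps_ring:
  assumes "W \<subseteq> {f. ps_convergent f}" "0 \<in> W"
    and "\<And>p q. p \<in> W \<Longrightarrow> q \<in> W \<Longrightarrow> p + q \<in> W" "\<And>c p. p \<in> W \<Longrightarrow> ps_mult (ps_const c) p \<in> W"
  shows "subgroup W (add_monoid conv_ps_ring)"
proof (rule conv_ps.add.subgroupI)
  show "a_inv conv_ps_ring p \<in> W" if "p \<in> W" for p
    using that assms by (subst a_inv_conv_ps_ring) auto
qed (use assms in auto)

lemma ideal_conv_ps_ring:
  assumes sub: "J \<subseteq> {f. ps_convergent f}" and "0 \<in> J"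
    and add: "\<And>p q. p \<in> J \<Longrightarrow> q \<in> J \<Longrightarrow> p + q \<in> J"
    and mult: "\<And>p q. p \<in> J \<Longrightarrow> ps_convergent q \<Longrightarrow> ps_mult q p \<in> J"
  shows "ideal J conv_ps_ring"
proof (rule idealI)
  show "ring conv_ps_ring" by (rule cring.axioms(1)[OF cring_conv_ps_ring])
  show "subgroup J (add_monoid conv_ps_ring)"
    by (rule subgroup_conv_ps_ring[OF sub \<open>0 \<in> J\<close> add mult[OF _ ps_convergent_const]])
qed (use mult in \<open>auto simp: ps_mult_commute\<close>)

lemma ps_mult_coeff_0: "ps_mult f g 0 = f 0 * g 0"
proof -
  have "{(\<alpha>, \<beta>). \<alpha> + \<beta> = (0 :: nat ^ 'a)} = {(0, 0)}"
    by (auto simp: vec_eq_iff)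
  then show ?thesis by (simp add: ps_mult_def)
qed

lemma subfield_constants: "subfield (range ps_const) (conv_ps_ring :: 'n::finite pseries ring)"
proof (rule conv_ps.subfieldI)
  have "subring (range ps_const) (conv_ps_ring :: 'n pseries ring)"
    by (rule conv_ps.subringI)
       (auto simp: ps_convergent_const ps_const_simps a_inv_conv_ps_ring)
  then show "subcring (range ps_const) (conv_ps_ring :: 'n pseries ring)"
    by (rule conv_ps.subcringI')
  have eq: "ps_const a = (ps_const b :: 'n pseries) \<longleftrightarrow> a = b" for a b
    by (auto simp: ps_const_def fun_eq_iff)
  have "ps_const c \<in> Units (conv_ps_ring\<lparr>carrier := range ps_const\<rparr> :: 'n pseries ring) \<longleftrightarrow> c \<noteq> 0" for c
    by (auto simp: Units_def ps_const_simps eq intro!: exI[of _ "inverse c"]) 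
  then show "Units (conv_ps_ring\<lparr>carrier := range ps_const\<rparr>) = range ps_const - {zero (conv_ps_ring :: 'n pseries ring)}"
    using eq[of 0 1] by (auto simp: Units_def ps_const_simps)
qed

section \<open>The weight filtration\<close>

definition weight_at_least :: "('n \<Rightarrow> real) \<Rightarrow> real \<Rightarrow> 'n::finite pseries \<Rightarrow> bool" where
  "weight_at_least w N p \<longleftrightarrow> (\<forall>\<alpha>. p \<alpha> \<noteq> 0 \<longrightarrow> N \<le> weight w \<alpha>)"

lemma weight_at_least_mult:
  assumes "weight_at_least w M p" "weight_at_least w N q"
  shows "weight_at_least w (M + N) (ps_mult p q)"
  unfolding weight_at_least_def
proof safe
  fix \<gamma> assume "ps_mult p q \<gamma> \<noteq> 0"
  then obtain \<alpha> \<beta> where "\<alpha> + \<beta> = \<gamma>" "p \<alpha> \<noteq> 0" "q \<beta> \<noteq> 0"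
    unfolding ps_mult_def by (elim sum.not_neutral_contains_not_neutral) auto
  then show "M + N \<le> weight w \<gamma>"
    using assms unfolding weight_at_least_def by (auto simp: weight_add intro!: add_mono)
qed

lemma weight_at_least_one: "weight_at_least w 0 (ps_const 1)"
  by (simp add: weight_at_least_def ps_const_def)

text \<open>The monomials \<open>g\<^sup>\<beta>\<close> in the generators of an ideal.\<close>
definition gen_monomial :: "('n \<Rightarrow> 'n pseries) \<Rightarrow> nat ^ 'n::finite \<Rightarrow> 'n pseries" where
  "gen_monomial g \<beta> = finprod conv_ps_ring (\<lambda>i. g i [^]\<^bsub>conv_ps_ring\<^esub> (\<beta> $ i)) UNIV"

context
  fixes g :: "'n::finite \<Rightarrow> 'n pseries"
  assumes conv_g: "\<And>i. ps_convergent (g i)"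
begin

lemma ps_convergent_power: "ps_convergent (g i [^]\<^bsub>conv_ps_ring\<^esub> (k :: nat))"
  using conv_ps.nat_pow_closed[of "g i" k] conv_g by simp

lemma gen_monomial_0: "gen_monomial g 0 = ps_const 1"
  using conv_ps.finprod_one[of UNIV] by (simp add: gen_monomial_def)

lemma gen_monomial_add_axis: "gen_monomial g (\<beta> + axis i 1) = ps_mult (g i) (gen_monomial g \<beta>)"
proof -
  let ?m = "\<lambda>\<beta> i. g i [^]\<^bsub>conv_ps_ring\<^esub> (\<beta> $ i)"
  have split: "gen_monomial g \<gamma> = ps_mult (?m \<gamma> i) (finprod conv_ps_ring (?m \<gamma>) (UNIV - {i}))" for \<gamma>
    using conv_ps.finprod_insert[of "UNIV - {i}" i "?m \<gamma>"] ps_convergent_power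
    by (simp add: gen_monomial_def insert_absorb Pi_def)
  have "finprod conv_ps_ring (?m (\<beta> + axis i 1)) (UNIV - {i}) = finprod conv_ps_ring (?m \<beta>) (UNIV - {i})"
    by (rule conv_ps.finprod_cong') (auto simp: ps_convergent_power axis_def)
  then show ?thesis
    unfolding split[of "\<beta> + axis i 1"] split[of \<beta>]
    by (simp add: ps_mult_assoc[symmetric] ps_mult_commute)
qed

lemma weight_at_least_gen_monomial:
  assumes "\<And>i. weight_at_least w (d i) (g i)"
  shows "weight_at_least w (weight d \<beta>) (gen_monomial g \<beta>)"
proof -
  have power: "weight_at_least w (d i * real k) (g i [^]\<^bsub>conv_ps_ring\<^esub> k)" for i k
  proof (induction k)
    case (Suc k)
    then show ?case
      using weight_at_least_mult[OF Suc assms[of i]] by (simp add: algebra_simps)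
  qed (simp add: weight_at_least_one)
  have "weight_at_least w (\<Sum>i\<in>A. d i * real (\<beta> $ i)) (finprod conv_ps_ring (\<lambda>i. g i [^]\<^bsub>conv_ps_ring\<^esub> (\<beta> $ i)) A)" for A
  proof (induction A rule: finite_induct[OF finite])
    case (2 i A)
    then show ?case
      using weight_at_least_mult[OF power 2(3)] ps_convergent_power by (simp add: Pi_def)
  qed (simp add: weight_at_least_one)
  then show ?thesis by (simp add: gen_monomial_def weight_def)
qed

end

section \<open>Hyperplanes below the Newton boundary\<close>

text \<open>Every point of the polyhedron is either strictly above the level \<open>m\<close> or in the convex
hull of the finitely many exponents of weight exactly \<open>m\<close>, because these two kinds of
points together form a convex set (\<open>C\<close> below) that contains all the shifted orthants.\<close>
lemma supporting_face_of_newton_polyhedron: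
  fixes f :: "'n::finite pseries"
  assumes w: "\<And>i. 0 < w i" and low: "\<And>\<alpha>. f \<alpha> \<noteq> 0 \<Longrightarrow> m \<le> weight w \<alpha>"
  shows "newton_polyhedron f \<inter> {x. (\<Sum>i\<in>UNIV. w i * x $ i) = m} face_of newton_polyhedron f"
    (is "?F face_of _")
    and "compact (newton_polyhedron f \<inter> {x. (\<Sum>i\<in>UNIV. w i * x $ i) = m})"
proof -
  define l where "l x = (\<Sum>i\<in>UNIV. w i * x $ i)" for x :: "real ^ 'n"
  have l_inner: "l x = (\<chi> i. w i) \<bullet> x" for x
    by (simp add: l_def inner_vec_def)
  have l_lin: "l (u *\<^sub>R x + v *\<^sub>R y) = u * l x + v * l y" for u v x y
    by (simp add: l_inner inner_simps)
  have l_add: "l (x + y) = l x + l y" for x y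
    by (simp add: l_inner inner_simps)
  define pt :: "nat ^ 'n \<Rightarrow> real ^ 'n" where "pt \<alpha> = (\<chi> i. real (\<alpha> $ i))" for \<alpha>
  have l_pt: "l (pt \<alpha>) = weight w \<alpha>" for \<alpha> by (simp add: l_def pt_def weight_def)
  define G where "G = (\<Union>\<alpha>\<in>{\<alpha>. f \<alpha> \<noteq> 0}. {pt \<alpha> + v | v. \<forall>i. 0 \<le> v $ i})"
  define T where "T = pt ` {\<alpha>. f \<alpha> \<noteq> 0 \<and> weight w \<alpha> = m}"
  have P: "newton_polyhedron f = convex hull G"
    by (simp add: newton_polyhedron_def G_def pt_def)
  have "finite {\<alpha>. weight w \<alpha> \<le> m}" using w by (rule finite_weight_le)
  then have "finite T" unfolding T_def
    by (intro finite_imageI) (rule rev_finite_subset, auto)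
  then have compact_T: "compact (convex hull T)"
    by (simp add: compact_convex_hull finite_imp_compact)
  have "T \<subseteq> {x. l x = m}" by (auto simp: T_def l_pt)
  moreover have "convex {x. l x = m}"
    by (simp add: l_inner convex_hyperplane)
  ultimately have T_level: "convex hull T \<subseteq> {x. l x = m}" by (rule hull_minimal)
  define C where "C = {x. l x > m} \<union> convex hull T"
  have C_ge: "l x \<ge> m" if "x \<in> C" for x
    using that T_level by (auto simp: C_def)
  have "convex C"
  proof (rule convexI)
    fix x y :: "real ^ 'n" and u v :: real
    assume xy: "x \<in> C" "y \<in> C" and uv: "0 \<le> u" "0 \<le> v" "u + v = 1"
    show "u *\<^sub>R x + v *\<^sub>R y \<in> C"
    proof (cases "u = 0 \<or> v = 0 \<or> x \<in> convex hull T \<and> y \<in> convex hull T")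
      case True
      then show ?thesis
        using xy uv convexD[OF convex_convex_hull[of T], of x y u v] by (auto simp: C_def)
    next
      case False
      then have "0 < u" "0 < v" "l x > m \<or> l y > m"
        using xy uv by (auto simp: C_def)
      then have "u * (l x - m) + v * (l y - m) > 0"
        using C_ge[OF xy(1)] C_ge[OF xy(2)]
        by (meson add_nonneg_pos add_pos_nonneg diff_gt_0_iff_gt diff_ge_0_iff_ge less_imp_le mult_nonneg_nonneg mult_pos_pos)
      moreover have "l (u *\<^sub>R x + v *\<^sub>R y) - m = u * (l x - m) + v * (l y - m)"
        using uv(3) unfolding l_lin by (auto simp: algebra_simps simp flip: distrib_left)
      ultimately show ?thesis by (simp add: C_def)
    qed
  qed
  moreover have "G \<subseteq> C"
  proof
    fix x assume "x \<in> G"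
    then obtain \<alpha> v where \<alpha>: "f \<alpha> \<noteq> 0" and v: "\<forall>i. 0 \<le> v $ i" and x: "x = pt \<alpha> + v"
      by (auto simp: G_def)
    have l_x: "l x = weight w \<alpha> + l v" by (simp add: x l_add l_pt)
    have v_nonneg: "0 \<le> w i * v $ i" for i
      using v w[of i] by simp
    then have "l v \<ge> 0" by (simp add: l_def sum_nonneg)
    show "x \<in> C"
    proof (cases "l v = 0 \<and> weight w \<alpha> = m")
      case True
      then have "\<forall>i\<in>UNIV. w i * v $ i = 0"
        using v_nonneg by (subst sum_nonneg_eq_0_iff[symmetric]) (auto simp: l_def)
      then have "v = 0" using w by (auto simp: vec_eq_iff less_le)
      with True \<alpha> have "x \<in> T" by (simp add: x T_def)
      then show ?thesis by (simp add: C_def hull_inc)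
    next
      case False
      then show ?thesis using low[OF \<alpha>] \<open>l v \<ge> 0\<close> by (auto simp: C_def l_x)
    qed
  qed
  ultimately have sub: "convex hull G \<subseteq> C" by (simp add: hull_minimal)
  have "T \<subseteq> G" unfolding T_def G_def by force
  then have "convex hull T \<subseteq> convex hull G" by (rule hull_mono)
  then have F: "newton_polyhedron f \<inter> {x. l x = m} = convex hull T"
    using sub T_level unfolding P C_def by auto
  show "compact (newton_polyhedron f \<inter> {x. (\<Sum>i\<in>UNIV. w i * x $ i) = m})"
    using compact_T F by (simp add: l_def)
  have "newton_polyhedron f \<inter> {x. (\<chi> i. w i) \<bullet> x = m} face_of newton_polyhedron f"
  proof (rule face_of_Int_supporting_hyperplane_ge)
    show "convex (newton_polyhedron f)" by (simp add: P)
    show "(\<chi> i. w i) \<bullet> x \<ge> m" if "x \<in> newton_polyhedron f" for x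
      using that sub C_ge by (auto simp: P l_inner)
  qed
  then show "?F face_of newton_polyhedron f"
    by (simp flip: l_inner add: l_def)
qed

text \<open>An exponent of minimal weight lies on the compact face where the weight attains its minimum over
the polyhedron, hence on the Newton boundary. This is how a condition on the boundary controls all
exponents of \<open>f\<close>.\<close>
lemma weight_ge_1_if_hyperplane_below:
  fixes f :: "'n::finite pseries" and a :: "real ^ 'n"
  assumes a: "\<And>i. 0 < a $ i" and below: "intercept_hyperplane_below a (newton_boundary f)"
    and \<beta>: "f \<beta> \<noteq> 0"
  shows "1 \<le> weight (\<lambda>i. 1 / a $ i) \<beta>"
proof -
  let ?w = "\<lambda>i. 1 / a $ i"
  have w: "0 < ?w i" for i using a by simp
  let ?S = "{\<alpha>. f \<alpha> \<noteq> 0 \<and> weight ?w \<alpha> \<le> weight ?w \<beta>}"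
  have "finite ?S"
    by (rule finite_subset[OF _ finite_weight_le[of ?w "weight ?w \<beta>"]]) (use w in auto)
  moreover have "\<beta> \<in> ?S" using \<beta> by simp
  ultimately obtain \<alpha> where \<alpha>: "\<alpha> \<in> ?S" and min: "\<And>\<gamma>. \<gamma> \<in> ?S \<Longrightarrow> weight ?w \<alpha> \<le> weight ?w \<gamma>"
    by (metis (no_types, lifting) empty_iff arg_min_if_finite(1) arg_min_least)
  have low: "weight ?w \<alpha> \<le> weight ?w \<gamma>" if "f \<gamma> \<noteq> 0" for \<gamma>
    using min[of \<gamma>] min[OF \<open>\<beta> \<in> ?S\<close>] that by (cases "\<gamma> \<in> ?S") auto
  let ?x = "\<chi> i. real (\<alpha> $ i)"
  let ?F = "newton_polyhedron f \<inter> {x. (\<Sum>i\<in>UNIV. ?w i * x $ i) = weight ?w \<alpha>}"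
  have "?x \<in> newton_polyhedron f"
    unfolding newton_polyhedron_def
    by (rule hull_inc, rule UN_I[of \<alpha>]) (use \<alpha> in \<open>auto intro!: exI[of _ 0]\<close>)
  then have "?x \<in> ?F" by (simp add: weight_def)
  moreover have "?F face_of newton_polyhedron f" "compact ?F"
    using supporting_face_of_newton_polyhedron[OF w low] by blast+
  ultimately have "?x \<in> newton_boundary f"
    unfolding newton_boundary_def by blast
  then have "1 \<le> (\<Sum>i\<in>UNIV. ?x $ i / a $ i)"
    using below unfolding intercept_hyperplane_below_def by blast
  also have "\<dots> = weight ?w \<alpha>" by (simp add: weight_def)
  also have "\<dots> \<le> weight ?w \<beta>" using low \<beta> by blast
  finally show ?thesis .
qed

section \<open>Counting monomials below a given weight\<close>

text \<open>Dimensions are counted in the complex vector space of all coefficient families, where truncated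
series live.\<close>
interpretation pseries_space: vector_space "\<lambda>(c :: complex) (p :: 'n::finite pseries) \<alpha>. c * p \<alpha>"
  by unfold_locales (auto simp: fun_eq_iff algebra_simps)

definition delta :: "nat ^ 'n \<Rightarrow> 'n::finite pseries" where
  "delta \<alpha> = (\<lambda>\<beta>. if \<beta> = \<alpha> then 1 else 0)"

lemma ps_convergent_delta: "ps_convergent (delta \<alpha>)"
  by (rule ps_convergent_finite_support, rule finite_subset[of _ "{\<alpha>}"]) (auto simp: delta_def)

lemma inj_delta: "inj delta"
  unfolding inj_def delta_def by (metis zero_neq_one)

lemma independent_delta:
  assumes "finite A"
  shows "pseries_space.independent (delta ` A)"
proof (rule pseries_space.independent_if_scalars_zero)
  fix c :: "'a pseries \<Rightarrow> complex" and p
  assume zero: "(\<Sum>p\<in>delta ` A. (\<lambda>\<beta>. c p * p \<beta>)) = 0" and "p \<in> delta ` A"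
  then obtain \<alpha> where \<alpha>: "p = delta \<alpha>" "\<alpha> \<in> A" by auto
  have sum_at: "(\<Sum>q\<in>B. (\<lambda>\<beta>. c q * q \<beta>)) \<alpha> = (\<Sum>q\<in>B. c q * q \<alpha>)" for B
    by (induction B rule: infinite_finite_induct) auto
  have "0 = (\<Sum>q\<in>delta ` A. c q * q \<alpha>)"
    using zero sum_at[of "delta ` A"] by simp
  also have "\<dots> = (\<Sum>\<beta>\<in>A. c (delta \<beta>) * delta \<beta> \<alpha>)"
    using inj_delta by (subst sum.reindex) (auto intro: inj_on_subset)
  also have "\<dots> = (\<Sum>\<beta>\<in>A. if \<alpha> = \<beta> then c (delta \<beta>) else 0)"
    by (rule sum.cong) (auto simp: delta_def)
  also have "\<dots> = c p" using \<open>finite A\<close> \<alpha> by simp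
  finally show "c p = 0" by simp
qed (use assms in simp)

definition trunc :: "('n \<Rightarrow> real) \<Rightarrow> real \<Rightarrow> 'n::finite pseries \<Rightarrow> 'n pseries" where
  "trunc w N p = (\<lambda>\<alpha>. if weight w \<alpha> \<le> N then p \<alpha> else 0)"

lemma trunc_add: "trunc w N (p + q) = trunc w N p + trunc w N q"
  by (auto simp: trunc_def fun_eq_iff)

lemma trunc_const_mult: "trunc w N (ps_mult (ps_const c) p) = (\<lambda>\<alpha>. c * trunc w N p \<alpha>)"
  by (auto simp: trunc_def ps_mult_const fun_eq_iff)

lemma trunc_eq_0:
  assumes "weight_at_least w M p" "N < M"
  shows "trunc w N p = 0"
  using assms by (force simp: trunc_def weight_at_least_def fun_eq_iff)

text \<open>For a subspace \<open>I\<close> of the convergent series this says that the classes of \<open>H\<close>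
span the quotient by \<open>I\<close>. Quantifying over the subspaces \<open>W\<close> that contain \<open>I\<close> and
\<open>H\<close> replaces explicit linear combinations: to show that every convergent series has a
linear property, it suffices to check \<open>I\<close> and \<open>H\<close>.\<close>
definition generates_modulo :: "'n::finite pseries set \<Rightarrow> 'n pseries set \<Rightarrow> bool" where
  "generates_modulo I H \<longleftrightarrow> (\<forall>W. I \<subseteq> W \<longrightarrow> H \<subseteq> W \<longrightarrow> W \<subseteq> {p. ps_convergent p} \<longrightarrow>
     (\<forall>p\<in>W. \<forall>q\<in>W. p + q \<in> W) \<longrightarrow> (\<forall>c. \<forall>p\<in>W. ps_mult (ps_const c) p \<in> W) \<longrightarrow>
     {p. ps_convergent p} \<subseteq> W)"

text \<open>The \<open>g\<close>-adic expansion modulo high weight: write \<open>p\<close> as a combination of \<open>H\<close> plus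
\<open>\<Sum>i. q i * g i\<close>. The first part times \<open>g\<^sup>\<beta>\<close> is in the span, and the second part
times \<open>g\<^sup>\<beta>\<close> is a sum of multiples of the monomials \<open>g\<^bsup>\<beta> + e\<^sub>i\<^esup>\<close>, to which the
argument applies again. It stops once the weight of \<open>\<beta>\<close> exceeds \<open>N\<close>, because then the
truncation vanishes. The induction is on the number of \<open>\<gamma>\<close> whose weight lies between that
of \<open>\<beta>\<close> and \<open>N\<close>.\<close>
lemma trunc_gen_monomial_in_span:
  fixes g :: "'n::finite \<Rightarrow> 'n pseries"
  assumes conv_g: "\<And>i. ps_convergent (g i)"
    and g: "\<And>i. weight_at_least w (d i) (g i)" and d: "\<And>i. 0 < d i"
    and H: "H \<subseteq> {h. ps_convergent h}"
    and gen: "generates_modulo (Idl\<^bsub>conv_ps_ring\<^esub> (range g)) H"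
    and p: "ps_convergent p" and w: "\<And>i. 0 \<le> w i"
  shows "trunc w N (ps_mult p (gen_monomial g \<beta>)) \<in> pseries_space.span
    ((\<lambda>(h, \<beta>). trunc w N (ps_mult h (gen_monomial g \<beta>))) ` (H \<times> {\<beta>. weight d \<beta> \<le> N}))"
  using p
proof (induction "card {\<gamma>. weight d \<beta> \<le> weight d \<gamma> \<and> weight d \<gamma> \<le> N}" arbitrary: p \<beta> rule: less_induct)
  case less
  define V where "V = pseries_space.span
    ((\<lambda>(h, \<beta>). trunc w N (ps_mult h (gen_monomial g \<beta>))) ` (H \<times> {\<beta>. weight d \<beta> \<le> N}))"
  define tail where "tail \<beta> = {\<gamma>. weight d \<beta> \<le> weight d \<gamma> \<and> weight d \<gamma> \<le> N}" for \<beta>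
  let ?T = "\<lambda>p. trunc w N (ps_mult p (gen_monomial g \<beta>))"
  have T_add: "?T (p + q) = ?T p + ?T q" for p q
    by (simp add: ps_mult_add_left trunc_add)
  have T_const: "?T (ps_mult (ps_const c) p) = (\<lambda>\<alpha>. c * ?T p \<alpha>)" for c p
    by (simp add: ps_mult_assoc trunc_const_mult)
  have T_zero: "trunc w N (0 :: 'n pseries) = 0" by (simp add: trunc_def fun_eq_iff)
  have V_add: "x + y \<in> V" if "x \<in> V" "y \<in> V" for x y
    using that unfolding V_def by (rule pseries_space.span_add)
  have V_scale: "(\<lambda>\<alpha>. c * x \<alpha>) \<in> V" if "x \<in> V" for c x
    using that unfolding V_def by (rule pseries_space.span_scale)
  have V_zero: "0 \<in> V" unfolding V_def by (rule pseries_space.span_zero)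
  have "?T p \<in> V"
  proof (cases "weight d \<beta> \<le> N")
    case False
    have "weight_at_least w 0 p"
      using w by (simp add: weight_at_least_def weight_nonneg)
    moreover have "weight_at_least w (weight d \<beta>) (gen_monomial g \<beta>)"
      using conv_g g by (rule weight_at_least_gen_monomial)
    ultimately have "weight_at_least w (0 + weight d \<beta>) (ps_mult p (gen_monomial g \<beta>))"
      by (rule weight_at_least_mult)
    then have "?T p = 0" using False by (intro trunc_eq_0) auto
    then show ?thesis using V_zero by simp
  next
    case True
    have step: "trunc w N (ps_mult q (gen_monomial g (\<beta> + axis i 1))) \<in> V" if "ps_convergent q" for q i
    proof -
      have "finite {\<gamma>. weight d \<gamma> \<le> N}" using d by (rule finite_weight_le)
      then have "finite (tail \<beta>)" by (rule rev_finite_subset) (auto simp: tail_def)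
      moreover have "tail (\<beta> + axis i 1) \<subset> tail \<beta>"
      proof
        show "tail (\<beta> + axis i 1) \<subseteq> tail \<beta>"
          using d[of i] by (auto simp: tail_def weight_add)
        have "\<beta> \<in> tail \<beta>" "\<beta> \<notin> tail (\<beta> + axis i 1)"
          using True d[of i] by (auto simp: tail_def weight_add)
        then show "tail (\<beta> + axis i 1) \<noteq> tail \<beta>" by blast
      qed
      ultimately have "card (tail (\<beta> + axis i 1)) < card (tail \<beta>)" by (rule psubset_card_mono)
      then show ?thesis
        using less.hyps[of "\<beta> + axis i 1" q] that unfolding V_def tail_def by blast
    qed
    \<comment> \<open>The factor \<open>q\<close> makes \<open>J\<close> an ideal, so that it contains the ideal generated by
      the \<open>g i\<close> as soon as it contains the \<open>g i\<close>.\<close>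
    define J where "J = {r. ps_convergent r \<and> (\<forall>q. ps_convergent q \<longrightarrow> ?T (ps_mult q r) \<in> V)}"
    have "ideal J conv_ps_ring"
      by (rule ideal_conv_ps_ring)
         (auto simp: J_def T_zero V_zero ps_mult_add_right T_add V_add ps_convergent_add
            ps_convergent_mult ps_convergent_const[of 0, unfolded ps_const_simps] simp flip: ps_mult_assoc)
    moreover have "range g \<subseteq> J"
    proof safe
      fix i
      have "?T (ps_mult q (g i)) = trunc w N (ps_mult q (gen_monomial g (\<beta> + axis i 1)))" for q
        by (simp only: gen_monomial_add_axis[OF conv_g] ps_mult_assoc)
      then show "g i \<in> J" using conv_g step by (simp add: J_def)
    qed
    ultimately have I_J: "Idl\<^bsub>conv_ps_ring\<^esub> (range g) \<subseteq> J" by (rule conv_ps.genideal_minimal)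
    define W where "W = {p. ps_convergent p \<and> ?T p \<in> V}"
    have "J \<subseteq> W"
    proof
      fix r assume r: "r \<in> J"
      then have "?T (ps_mult (ps_const 1) r) \<in> V" unfolding J_def using ps_convergent_const by blast
      then show "r \<in> W" using r by (simp add: J_def W_def)
    qed
    with I_J have I_W: "Idl\<^bsub>conv_ps_ring\<^esub> (range g) \<subseteq> W" by blast
    have H_W: "H \<subseteq> W"
    proof
      fix h assume "h \<in> H"
      then have "?T h \<in> V" unfolding V_def using True by (intro pseries_space.span_base) force
      then show "h \<in> W" using H \<open>h \<in> H\<close> by (auto simp: W_def)
    qed
    have "{p. ps_convergent p} \<subseteq> W"
      by (rule gen[unfolded generates_modulo_def, rule_format, OF I_W H_W])
         (auto simp: W_def T_add T_const V_add V_scale ps_convergent_add ps_convergent_mult ps_convergent_const)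
    then show ?thesis using less.prems by (auto simp: W_def)
  qed
  then show ?case by (simp add: V_def)
qed

text \<open>The left-hand side is the dimension of the space of truncated series, which has the monomials
of weight at most \<open>N\<close> as a basis; the right-hand side bounds the number of products
\<open>h * g\<^sup>\<beta>\<close> that span it.\<close>
lemma card_sublevel_le:
  fixes g :: "'n::finite \<Rightarrow> 'n pseries"
  assumes conv_g: "\<And>i. ps_convergent (g i)"
    and g: "\<And>i. weight_at_least w (d i) (g i)" and d: "\<And>i. 0 < d i" and w: "\<And>i. 0 < w i"
    and H: "finite H" "H \<subseteq> {h. ps_convergent h}"
    and gen: "generates_modulo (Idl\<^bsub>conv_ps_ring\<^esub> (range g)) H"
  shows "card {\<alpha>. weight w \<alpha> \<le> N} \<le> card H * card {\<beta>. weight d \<beta> \<le> N}"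
proof -
  have fin_w: "finite {\<alpha>. weight w \<alpha> \<le> N}" and fin_d: "finite {\<beta>. weight d \<beta> \<le> N}"
    using w d by (auto intro: finite_weight_le)
  let ?A = "{\<alpha>. weight w \<alpha> \<le> N}" and ?B = "{\<beta>. weight d \<beta> \<le> N}"
  let ?S = "(\<lambda>(h, \<beta>). trunc w N (ps_mult h (gen_monomial g \<beta>))) ` (H \<times> ?B)"
  have "delta ` ?A \<subseteq> pseries_space.span ?S"
  proof safe
    fix \<alpha> assume "weight w \<alpha> \<le> N"
    then have "delta \<alpha> = trunc w N (ps_mult (delta \<alpha>) (gen_monomial g 0))"
      by (auto simp: gen_monomial_0[OF conv_g] trunc_def delta_def fun_eq_iff)
    also have "\<dots> \<in> pseries_space.span ?S"
      using w by (intro trunc_gen_monomial_in_span[OF conv_g g d H(2) gen ps_convergent_delta])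
        (simp add: less_imp_le)
    finally show "delta \<alpha> \<in> pseries_space.span ?S" .
  qed
  moreover have "finite ?S" using H(1) fin_d by blast
  ultimately have "card (delta ` ?A) \<le> card ?S"
    using pseries_space.independent_span_bound[OF _ independent_delta] fin_w by blast
  also have "card ?S \<le> card (H \<times> ?B)" using H(1) fin_d by (intro card_image_le) blast
  also have "card (delta ` ?A) = card ?A" by (intro card_image inj_on_subset[OF inj_delta]) auto
  finally show ?thesis by (simp add: card_cartesian_product)
qed

section \<open>Comparing counting functions by the Laplace transform\<close>

lemma exp_neg_as_tail_integral:
  "(\<integral>\<^sup>+N. ennreal (exp (- N)) * indicator {s..} N \<partial>lborel) = ennreal (exp (- s))"
proof -
  have "(\<integral>\<^sup>+N. ennreal (exp (- N)) * indicator {s..} N \<partial>lborel) = ennreal (0 - (- exp (- s)))"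
  proof (rule nn_integral_FTC_atLeast)
    show "((\<lambda>N::real. - exp (- N)) \<longlongrightarrow> 0) at_top" by real_asymp
  qed (auto intro!: derivative_eq_intros)
  then show ?thesis by simp
qed

text \<open>Each summand is a tail integral of the exponential; interchanging sum and integral counts, at
\<open>N\<close>, the indices whose tail has begun.\<close>
lemma laplace_transform_of_counting_function:
  fixes u :: "'a::countable \<Rightarrow> real"
  assumes fin: "\<And>N. finite {x. u x \<le> N}"
  shows "(\<integral>\<^sup>+x. ennreal (exp (- u x)) \<partial>count_space UNIV)
    = (\<integral>\<^sup>+N. ennreal (exp (- N)) * of_nat (card {x. u x \<le> N}) \<partial>lborel)"
proof -
  have "(\<integral>\<^sup>+x. ennreal (exp (- u x)) \<partial>count_space UNIV)
      = (\<integral>\<^sup>+x. \<integral>\<^sup>+N. ennreal (exp (- N)) * indicator {u x..} N \<partial>lborel \<partial>count_space UNIV)"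
    by (simp add: exp_neg_as_tail_integral)
  also have "\<dots> = (\<integral>\<^sup>+N. \<integral>\<^sup>+x. ennreal (exp (- N)) * indicator {u x..} N \<partial>count_space UNIV \<partial>lborel)"
    by (rule nn_integral_count_space_nn_integral[symmetric]) auto
  also have "\<dots> = (\<integral>\<^sup>+N. ennreal (exp (- N)) * of_nat (card {x. u x \<le> N}) \<partial>lborel)"
  proof (rule nn_integral_cong)
    fix N :: real
    have "(\<integral>\<^sup>+x. ennreal (exp (- N)) * indicator {u x..} N \<partial>count_space UNIV)
        = (\<integral>\<^sup>+x. ennreal (exp (- N)) * indicator {x. u x \<le> N} x \<partial>count_space UNIV)"
      by (rule nn_integral_cong) (auto simp: indicator_def)
    also have "\<dots> = ennreal (exp (- N)) * emeasure (count_space UNIV) {x. u x \<le> N}"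
      by (rule nn_integral_cmult_indicator) simp
    finally show "(\<integral>\<^sup>+x. ennreal (exp (- N)) * indicator {u x..} N \<partial>count_space UNIV)
        = ennreal (exp (- N)) * of_nat (card {x. u x \<le> N})"
      using fin[of N] by simp
  qed
  finally show ?thesis .
qed

lemma exp_sum_le_if_counting_le:
  fixes u :: "'a::countable \<Rightarrow> real" and v :: "'b::countable \<Rightarrow> real"
  assumes fin: "\<And>N. finite {x. u x \<le> N}" "\<And>N. finite {y. v y \<le> N}"
    and count: "\<And>N. card {x. u x \<le> N} \<le> m * card {y. v y \<le> N}"
  shows "(\<integral>\<^sup>+x. ennreal (exp (- u x)) \<partial>count_space UNIV)
    \<le> of_nat m * (\<integral>\<^sup>+y. ennreal (exp (- v y)) \<partial>count_space UNIV)"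
proof -
  have "mono (\<lambda>N. real (card {y. v y \<le> N}))"
    by (auto intro!: monoI card_mono fin)
  then have "(\<lambda>N. real (card {y. v y \<le> N})) \<in> borel_measurable borel"
    by (rule borel_measurable_mono)
  then have [measurable]: "(\<lambda>N. of_nat (card {y. v y \<le> N}) :: ennreal) \<in> borel_measurable borel"
    unfolding ennreal_of_nat_eq_real_of_nat by simp
  have "(\<integral>\<^sup>+x. ennreal (exp (- u x)) \<partial>count_space UNIV)
      \<le> (\<integral>\<^sup>+N. of_nat m * (ennreal (exp (- N)) * of_nat (card {y. v y \<le> N})) \<partial>lborel)"
    unfolding laplace_transform_of_counting_function[OF fin(1)]
  proof (rule nn_integral_mono)
    fix N :: real
    have "of_nat (card {x. u x \<le> N}) \<le> (of_nat (m * card {y. v y \<le> N}) :: ennreal)"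
      using count by (simp only: of_nat_le_iff)
    then have "ennreal (exp (- N)) * of_nat (card {x. u x \<le> N})
        \<le> ennreal (exp (- N)) * of_nat (m * card {y. v y \<le> N})"
      by (rule mult_left_mono) simp
    then show "ennreal (exp (- N)) * of_nat (card {x. u x \<le> N})
        \<le> of_nat m * (ennreal (exp (- N)) * of_nat (card {y. v y \<le> N}))"
      by (simp add: mult_ac)
  qed
  also have "\<dots> = of_nat m * (\<integral>\<^sup>+y. ennreal (exp (- v y)) \<partial>count_space UNIV)"
    unfolding laplace_transform_of_counting_function[OF fin(2)]
    by (rule nn_integral_cmult) measurable
  finally show ?thesis .
qed

text \<open>The sum over all multi-indices factors into one geometric series for each coordinate.\<close>
lemma generating_function_of_weight:
  fixes w :: "'n::finite \<Rightarrow> real"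
  assumes w: "\<And>i. 0 < w i"
  shows "(\<integral>\<^sup>+\<alpha>. ennreal (exp (- weight w \<alpha>)) \<partial>count_space UNIV)
    = ennreal (\<Prod>i\<in>UNIV. 1 / (1 - exp (- w i)))"
proof -
  interpret product_sigma_finite "\<lambda>_ :: 'n. count_space (UNIV :: nat set)"
    by (simp add: product_sigma_finite_def sigma_finite_measure_count_space)
  have factor: "(\<integral>\<^sup>+k. ennreal (exp (- (w i * real k))) \<partial>count_space UNIV) = ennreal (1 / (1 - exp (- w i)))" for i
  proof -
    have "(\<lambda>k. exp (- w i) ^ k) sums (1 / (1 - exp (- w i)))"
      by (rule geometric_sums) (use w in simp)
    then have "(\<Sum>k. ennreal (exp (- w i) ^ k)) = ennreal (1 / (1 - exp (- w i)))"
      by (rule suminf_ennreal_eq[rotated]) simp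
    moreover have "exp (- (w i * real k)) = exp (- w i) ^ k" for k
      by (simp add: mult_ac flip: exp_of_nat_mult)
    ultimately show ?thesis
      by (simp only: nn_integral_count_space_nat)
  qed
  have "(\<integral>\<^sup>+\<alpha>. ennreal (exp (- weight w \<alpha>)) \<partial>count_space UNIV)
      = (\<integral>\<^sup>+g. ennreal (exp (- weight w (vec_lambda g))) \<partial>count_space UNIV)"
    by (rule nn_integral_bij_count_space[symmetric])
       (metis UNIV_I bij_betw_byWitness subset_UNIV vec_lambda_inverse vec_nth_inverse)
  also have "\<dots> = (\<integral>\<^sup>+g. (\<Prod>i\<in>UNIV. ennreal (exp (- (w i * real (g i))))) \<partial>count_space UNIV)"
    by (simp add: weight_def prod_ennreal exp_sum flip: sum_negf)
  also have "count_space UNIV = PiM (UNIV :: 'n set) (\<lambda>_. count_space (UNIV :: nat set))"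
    using count_space_PiM_finite[of "UNIV :: 'n set" "\<lambda>_. UNIV :: nat set"] by simp
  also have "(\<integral>\<^sup>+g. (\<Prod>i\<in>UNIV. ennreal (exp (- (w i * real (g i))))) \<partial>PiM UNIV (\<lambda>_. count_space UNIV))
      = (\<Prod>i\<in>UNIV. ennreal (1 / (1 - exp (- w i))))"
    by (subst product_nn_integral_prod) (auto simp: factor)
  also have "\<dots> = ennreal (\<Prod>i\<in>UNIV. 1 / (1 - exp (- w i)))"
    by (rule prod_ennreal) (use w in \<open>simp add: less_imp_le\<close>)
  finally show ?thesis .
qed

lemma weight_scale: "weight (\<lambda>i. t * w i) \<alpha> = t * weight w \<alpha>"
  by (simp add: weight_def sum_distrib_left mult_ac)

text \<open>Up to the common factor \<open>N ^ n / n!\<close> the two counts grow like the volumes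
\<open>1 / (\<Prod>i. w i)\<close> and \<open>1 / (\<Prod>i. d i)\<close> of simplices. Passing to the generating
functions at \<open>exp (- t)\<close> and letting \<open>t\<close> tend to \<open>0\<close> extracts the ratio of the
volumes without any estimate of lattice points.\<close>
lemma prod_ratio_le_if_counting_le:
  fixes w d :: "'n::finite \<Rightarrow> real"
  assumes w: "\<And>i. 0 < w i" and d: "\<And>i. 0 < d i"
    and count: "\<And>N. card {\<alpha>. weight w \<alpha> \<le> N} \<le> m * card {\<beta>. weight d \<beta> \<le> N}"
  shows "(\<Prod>i\<in>UNIV. d i / w i) \<le> real m"
proof -
  have bound: "(\<Prod>i\<in>UNIV. (1 - exp (- (t * d i))) / (1 - exp (- (t * w i)))) \<le> real m" if "t > 0" for t
  proof -
    define W where "W = (\<Prod>i\<in>UNIV. 1 / (1 - exp (- (t * w i))))"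
    define D where "D = (\<Prod>i\<in>UNIV. 1 / (1 - exp (- (t * d i))))"
    have sublevel: "{\<alpha>. weight (\<lambda>i. t * c i) \<alpha> \<le> N} = {\<alpha>. weight c \<alpha> \<le> N / t}" for c :: "'n \<Rightarrow> real" and N
      using \<open>t > 0\<close> by (auto simp: weight_scale field_simps)
    have fin: "finite {\<alpha>. weight (\<lambda>i. t * c i) \<alpha> \<le> N}" if "\<And>i. 0 < c i" for c :: "'n \<Rightarrow> real" and N
      unfolding sublevel using that by (rule finite_weight_le)
    have "ennreal W \<le> of_nat m * ennreal D"
      using exp_sum_le_if_counting_le[OF fin[of w] fin[of d], of m]
        generating_function_of_weight[of "\<lambda>i. t * w i"] generating_function_of_weight[of "\<lambda>i. t * d i"]
        w d count \<open>t > 0\<close> by (simp add: sublevel W_def D_def)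
    moreover have "D > 0" unfolding D_def using d \<open>t > 0\<close> by (intro prod_pos) auto
    ultimately have "W \<le> real m * D"
      by (simp add: ennreal_of_nat_eq_real_of_nat flip: ennreal_mult)
    then have "W / D \<le> real m" using \<open>D > 0\<close> by (simp add: field_simps)
    then show ?thesis by (simp add: W_def D_def flip: prod_dividef)
  qed
  have "((\<lambda>t. \<Prod>i\<in>UNIV. (1 - exp (- (t * d i))) / (1 - exp (- (t * w i)))) \<longlongrightarrow> (\<Prod>i\<in>UNIV. d i / w i)) (at_right 0)"
  proof (intro tendsto_prod)
    fix i
    have "0 < w i" "0 < d i" using w d by auto
    then show "((\<lambda>t. (1 - exp (- (t * d i))) / (1 - exp (- (t * w i)))) \<longlongrightarrow> d i / w i) (at_right 0)"
      by (simp only: divide_inverse) real_asymp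
  qed
  then show ?thesis
    by (rule tendsto_upperbound) (auto simp: eventually_at_right_less bound intro!: eventually_at_rightI[of 0 1])
qed

section \<open>The Milnor number\<close>

text \<open>Any lift of a basis of the Milnor algebra will do as \<open>H\<close>. The partial derivatives must
vanish at the origin: this makes the Jacobian ideal proper, so that the constants form a field in
the quotient and its dimension is well defined.\<close>
lemma milnor_algebra_generators:
  fixes f :: "'n::finite pseries"
  assumes conv: "ps_convergent f" and crit: "\<And>i. ps_partial i f 0 = 0"
    and fin: "ring.finite_dimension (milnor_algebra f) (milnor_scalars f) (carrier (milnor_algebra f))"
  obtains H where "finite H" "H \<subseteq> {h. ps_convergent h}" "generates_modulo (jacobian_ideal f) H"
    "card H \<le> ring.dim (milnor_algebra f) (milnor_scalars f) (carrier (milnor_algebra f))"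
proof -
  let ?R = "conv_ps_ring :: 'n pseries ring" and ?I = "jacobian_ideal f"
  let ?Q = "milnor_algebra f" and ?K = "milnor_scalars f"
  have "ideal ?I ?R"
    unfolding jacobian_ideal_def
    by (rule conv_ps.genideal_ideal) (auto intro: ps_convergent_partial conv)
  then interpret I: ideal ?I ?R .
  interpret Q: ring ?Q
    unfolding milnor_algebra_def by (rule I.quotient_is_ring)
  let ?\<pi> = "\<lambda>p. ?I +>\<^bsub>?R\<^esub> p"
  interpret \<pi>: ring_hom_ring ?R ?Q ?\<pi>
    unfolding milnor_algebra_def by (rule I.rcos_ring_hom_ring)
  have "?I \<subseteq> {p. ps_convergent p \<and> p 0 = 0}"
    unfolding jacobian_ideal_def
    by (rule conv_ps.genideal_minimal, rule ideal_conv_ps_ring)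
       (auto simp: ps_mult_coeff_0 ps_convergent_add ps_convergent_mult crit
         ps_convergent_const[of 0, unfolded ps_const_simps] intro: ps_convergent_partial conv)
  then have not_one: "ps_const 1 \<notin> ?I" by (auto simp: ps_const_def)
  have "\<one>\<^bsub>?Q\<^esub> \<noteq> \<zero>\<^bsub>?Q\<^esub>"
  proof
    assume "\<one>\<^bsub>?Q\<^esub> = \<zero>\<^bsub>?Q\<^esub>"
    then have "?\<pi> (ps_const 1) = ?I"
      by (simp add: milnor_algebra_def FactRing_def)
    moreover have "ps_const 1 \<in> ?\<pi> (ps_const 1)"
      by (rule I.a_rcos_self) (simp add: ps_convergent_const)
    ultimately show False using not_one by simp
  qed
  with \<pi>.img_is_subfield(2)[OF subfield_constants]
  have K: "subfield ?K ?Q" by (simp add: milnor_scalars_def image_image)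
  let ?m = "Q.dim ?K (carrier ?Q)"
  have "Q.dimension ?m ?K (carrier ?Q)"
    using Q.finite_dimensionE[OF K fin] by (simp add: over_def)
  from Q.exists_base[OF K this]
  obtain Us where Us: "set Us \<subseteq> carrier ?Q" "length Us = ?m" "Q.Span ?K Us = carrier ?Q"
    by blast
  have Q_carrier: "carrier ?Q = ?\<pi> ` {p. ps_convergent p}"
    by (auto simp: milnor_algebra_def FactRing_def A_RCOSETS_def')
  obtain H where H: "H \<subseteq> {p. ps_convergent p}" "finite H" "?\<pi> ` H = set Us" "card H \<le> ?m"
  proof -
    have "set Us \<subseteq> ?\<pi> ` {p. ps_convergent p}" using Us(1) Q_carrier by simp
    then obtain H where "H \<subseteq> {p. ps_convergent p}" "inj_on ?\<pi> H" "set Us = ?\<pi> ` H"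
      unfolding subset_image_inj by blast
    moreover from this have "finite H" "card H = card (set Us)"
      by (metis finite_imageD List.finite_set, simp add: card_image)
    ultimately show thesis
      using that[of H] card_length[of Us] Us(2) by simp
  qed
  have "generates_modulo ?I H"
    unfolding generates_modulo_def
  proof (intro allI impI subsetI)
    fix W and p :: "'n pseries"
    assume W: "?I \<subseteq> W" "H \<subseteq> W" "W \<subseteq> {p. ps_convergent p}" "\<forall>p\<in>W. \<forall>q\<in>W. p + q \<in> W"
      "\<forall>c. \<forall>p\<in>W. ps_mult (ps_const c) p \<in> W" and p: "p \<in> {p. ps_convergent p}"
    have "0 \<in> W" using W(1) I.zero_closed by auto
    then have "subgroup W (add_monoid ?R)"
      by (intro subgroup_conv_ps_ring) (use W in auto)
    then have subgroup: "subgroup (?\<pi> ` W) (add_monoid ?Q)"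
      using group_hom.subgroup_img_is_subgroup[OF \<pi>.a_group_hom] by blast
    have "?K <#>\<^bsub>?Q\<^esub> set Us \<subseteq> ?\<pi> ` W"
    proof
      fix x assume "x \<in> ?K <#>\<^bsub>?Q\<^esub> set Us"
      then obtain c h where "h \<in> H" "x = ?\<pi> (ps_const c) \<otimes>\<^bsub>?Q\<^esub> ?\<pi> h"
        unfolding set_mult_def milnor_scalars_def H(3)[symmetric] by auto
      moreover from this have "x = ?\<pi> (ps_mult (ps_const c) h)"
        using \<pi>.hom_mult[of "ps_const c" h] H(1) by (auto simp: ps_convergent_const)
      ultimately show "x \<in> ?\<pi> ` W" using W(2,5) by blast
    qed
    then have "carrier ?Q \<subseteq> ?\<pi> ` W"
      using Q.Span_min[OF K Us(1) subgroup] Us(3) by simp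
    then obtain q where q: "q \<in> W" "?\<pi> p = ?\<pi> q" using p Q_carrier by blast
    have "p \<in> ?\<pi> p" by (rule I.a_rcos_self) (use p in simp)
    then have "p \<in> ?\<pi> q" by (simp add: q)
    then obtain r where "r \<in> ?I" "p = r + q" by (auto simp: a_r_coset_def')
    then show "p \<in> W" using W q by blast
  qed
  then show thesis using that H by blast
qed

theorem corollary3p1:
  fixes f :: "'n::finite pseries" and a :: "real ^ 'n"
  assumes "ps_convergent f"
    and "isolated_singularity f"
    and "\<forall>i. a $ i \<ge> 1"
    and "intercept_hyperplane_below a (newton_boundary f)"
  shows "ereal_of_enat (milnor_number f) \<ge> ereal (\<Prod>i\<in>UNIV. (a $ i - 1))"
proof (cases "ring.finite_dimension (milnor_algebra f) (milnor_scalars f) (carrier (milnor_algebra f))")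
  case False
  then show ?thesis by (simp add: milnor_number_def)
next
  case True
  let ?m = "ring.dim (milnor_algebra f) (milnor_scalars f) (carrier (milnor_algebra f))"
  have "(\<Prod>i\<in>UNIV. (a $ i - 1)) \<le> real ?m"
  \<comment> \<open>If some intercept is \<open>1\<close>, then the corresponding \<open>d i\<close> is \<open>0\<close> and
    there are infinitely many \<open>\<beta>\<close> of bounded weight, but then the product is \<open>0\<close>.\<close>
  proof (cases "\<exists>i. a $ i = 1")
    case True
    then have "(\<Prod>i\<in>UNIV. (a $ i - 1)) = 0" by (intro prod_zero) auto
    then show ?thesis by (simp only: of_nat_0_le_iff)
  next
    case False
    with assms(3) have a: "1 < a $ i" for i by (metis less_le)
    have a_pos: "0 < a $ i" for i using a[of i] by simp
    define w where "w i = 1 / a $ i" for i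
    define d where "d i = 1 - 1 / a $ i" for i
    have w: "0 < w i" and d: "0 < d i" for i using a[of i] by (auto simp: w_def d_def)
    \<comment> \<open>Differentiation by the \<open>i\<close>-th variable lowers an exponent by one, hence its weight,
      which is at least \<open>1\<close>, by \<open>w i\<close>.\<close>
    have partial: "weight_at_least w (d i) (ps_partial i f)" for i
      unfolding weight_at_least_def
    proof safe
      fix \<alpha> assume "ps_partial i f \<alpha> \<noteq> 0"
      then have "f (\<alpha> + axis i 1) \<noteq> 0" by (auto simp: ps_partial_def)
      from weight_ge_1_if_hyperplane_below[OF a_pos assms(4) this]
      have "1 \<le> weight w \<alpha> + w i" unfolding w_def[abs_def] weight_add by simp
      then show "d i \<le> weight w \<alpha>" by (simp add: d_def w_def)
    qed
    have crit: "ps_partial i f 0 = 0" for i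
      using partial[of i] d[of i] unfolding weight_at_least_def by fastforce
    obtain H where H: "finite H" "H \<subseteq> {h. ps_convergent h}" "generates_modulo (jacobian_ideal f) H"
      and card_H: "card H \<le> ?m"
      using milnor_algebra_generators[OF assms(1) crit True] .
    have "(\<Prod>i\<in>UNIV. d i / w i) \<le> real (card H)"
      by (rule prod_ratio_le_if_counting_le[OF w d])
         (rule card_sublevel_le[OF ps_convergent_partial[OF assms(1)] partial d w H(1,2)
            H(3)[unfolded jacobian_ideal_def]])
    moreover have "d i / w i = a $ i - 1" for i
      using a_pos[of i] by (simp add: d_def w_def field_simps)
    ultimately show ?thesis using card_H by simp
  qed
  then show ?thesis using True by (simp add: milnor_number_def)
qed

end
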